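(* Let $W_1$ be the Lie algebra of real formal vector fields in one variable $x$ and $F_\lambda$ the $W_1$-module of formal $\lambda$-densities. Let $\partial:H^2(W_1,F_1)\to H^3(W_1,\mathbb R)$ be the connecting homomorphism in continuous cohomology associated to the short exact sequence of $W_1$-modules $$0\to\mathbb R\to F_0\xrightarrow{d_{DR}}F_1\to0 .$$ Let $\alpha$ be the $2$-cocycle $$\alpha\left(f\tfrac{d}{dx},g\tfrac{d}{dx}\right)=\begin{vmatrix} f'&g'\\ f''&g''\end{vmatrix}(x)\,(dx)^1$$ with values in $F_1$, and $\theta(0)$ the Godbillon–Vey $3$-cocycle $$\theta(0)\left(f\tfrac{d}{dx},g\tfrac{d}{dx},h\tfrac{d}{dx}\right)=\begin{vmatrix} f&g&h\\ f'&g'&h'\\ f''&g''&h''\end{vmatrix}(0).$$ Then $\partial\alpha=\theta(0)$.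
   Context: $F_\lambda$ is the space of formal power series $a(x)(dx)^\lambda$ with real coefficients, with action $f\frac{d}{dx}\cdot a(dx)^\lambda=(fa'+\lambda af')(dx)^\lambda$. $d_{DR}(a)=a'\,(dx)^1$ is the formal de Rham differential, $\mathbb R\to F_0$ the inclusion of constants. Formal power series spaces carry the topology of coefficientwise convergence; cochains are continuous. The coboundary of a $2$-cochain is $dc(X,Y,Z)=\sum_{\rm cycl.}X\cdot c(Y,Z)-\sum_{\rm cycl.}c([X,Y],Z)$. The connecting homomorphism is defined by lifting $\alpha$ to a cochain with values in $F_0$ and applying the coboundary, the result taking values in $\mathbb R$; the identity is one of cohomology classes. *)

theory Defs
  imports "HOL-Analysis.Analysis"
begin

unbundle no vec_syntax
unbundle fps_syntax

instantiation fps :: (real_vector) real_vector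
begin

definition scaleR_fps :: "real \<Rightarrow> 'a fps \<Rightarrow> 'a fps"
  where "scaleR_fps r a = Abs_fps (\<lambda>n. r *\<^sub>R (a $ n))"

lemma fps_nth_scaleR [simp]: "(r *\<^sub>R a) $ n = r *\<^sub>R (a $ n)"
  by (simp add: scaleR_fps_def)

instance
  by standard (simp_all add: fps_eq_iff scaleR_add_right scaleR_add_left)

end

lemma fps_scaleR_conv: "r *\<^sub>R a = fps_const r * (a :: real fps)"
  by (simp add: fps_eq_iff)

text \<open>
  The topology of coefficientwise convergence, each coefficient carrying the usual topology of
  the reals. The metric on \<^typ>\<open>real fps\<close> provided by the library is the \<open>X\<close>-adic one, which
  corresponds to discrete coefficients, so it is not used here.
\<close>

definition fps_coeff_topology :: "real fps topology"
  where "fps_coeff_topology =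
    pullback_topology UNIV fps_nth (product_topology (\<lambda>_::nat. euclideanreal) UNIV)"

text \<open>
  A series \<open>f\<close> stands for the vector field \<open>f d/dx\<close> when regarded as an element of \<open>W\<^sub>1\<close>, and for
  the density \<open>f (dx)\<^sup>\<lambda>\<close> when regarded as an element of \<open>F\<^sub>\<lambda>\<close>. The underlying vector space of a
  \<open>W\<^sub>1\<close>-module is its whole type.
\<close>

definition W1_bracket :: "real fps \<Rightarrow> real fps \<Rightarrow> real fps"
  where "W1_bracket f g = f * fps_deriv g - fps_deriv f * g"

record 'm W1_module =
  act :: "real fps \<Rightarrow> 'm \<Rightarrow> 'm"
  mtopology :: "'m topology"

definition densities :: "real \<Rightarrow> real fps W1_module"
  where "densities l =
    \<lparr>act = (\<lambda>f a. f * fps_deriv a + l *\<^sub>R (fps_deriv f * a)),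
     mtopology = fps_coeff_topology\<rparr>"

definition trivial_module :: "real W1_module"
  where "trivial_module = \<lparr>act = (\<lambda>f r. 0), mtopology = euclideanreal\<rparr>"

definition d_DR :: "real fps \<Rightarrow> real fps"
  where "d_DR a = fps_deriv a"

text \<open>
  A \<open>q\<close>-cochain is a function on lists of \<open>q\<close> vector fields, extended by \<open>0\<close> to lists of any other
  length so that cochains are determined by their values on \<open>q\<close>-tuples.
\<close>

definition cochains :: "'m::real_vector W1_module \<Rightarrow> nat \<Rightarrow> (real fps list \<Rightarrow> 'm) set"
  where "cochains M q = {c.
    (\<forall>xs. length xs \<noteq> q \<longrightarrow> c xs = 0) \<and>
    (\<forall>xs i. length xs = q \<and> i < q \<longrightarrow> linear (\<lambda>v. c (xs[i := v]))) \<and>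
    (\<forall>xs. length xs = q \<and> \<not> distinct xs \<longrightarrow> c xs = 0) \<and>
    continuous_map (product_topology (\<lambda>_. fps_coeff_topology) {..<q}) (mtopology M)
      (\<lambda>v. c (map v [0..<q]))}"

text \<open>
  The Chevalley--Eilenberg differential in all degrees at once: on a \<open>q\<close>-cochain only lists of
  length \<open>q + 1\<close> give a nonzero value. The list \<open>nths xs (- {i})\<close> is \<open>xs\<close> with entry \<open>i\<close> removed.
\<close>

definition coboundary ::
    "'m::real_vector W1_module \<Rightarrow> (real fps list \<Rightarrow> 'm) \<Rightarrow> real fps list \<Rightarrow> 'm"
  where "coboundary M c xs =
    (\<Sum>i<length xs. (-1) ^ i *\<^sub>R act M (xs ! i) (c (nths xs (- {i})))) +
    (\<Sum>j<length xs. \<Sum>i<j.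
      (-1) ^ (i + j) *\<^sub>R c (W1_bracket (xs ! i) (xs ! j) # nths xs (- {i, j})))"

definition cocycles :: "'m::real_vector W1_module \<Rightarrow> nat \<Rightarrow> (real fps list \<Rightarrow> 'm) set"
  where "cocycles M q = {c \<in> cochains M q. \<forall>xs. coboundary M c xs = 0}"

definition coboundaries :: "'m::real_vector W1_module \<Rightarrow> nat \<Rightarrow> (real fps list \<Rightarrow> 'm) set"
  where "coboundaries M q =
    (if q = 0 then {\<lambda>_. 0} else coboundary M ` cochains M (q - 1))"

definition cohomologous ::
    "'m::real_vector W1_module \<Rightarrow> nat \<Rightarrow> ((real fps list \<Rightarrow> 'm) \<times> (real fps list \<Rightarrow> 'm)) set"
  where "cohomologous M q =
    {(c, c'). c \<in> cocycles M q \<and> c' \<in> cocycles M q \<and> (\<lambda>xs. c' xs - c xs) \<in> coboundaries M q}"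

definition cohomology ::
    "'m::real_vector W1_module \<Rightarrow> nat \<Rightarrow> (real fps list \<Rightarrow> 'm) set set"
  where "cohomology M q = cocycles M q // cohomologous M q"

definition cohomology_class ::
    "'m::real_vector W1_module \<Rightarrow> nat \<Rightarrow> (real fps list \<Rightarrow> 'm) \<Rightarrow> (real fps list \<Rightarrow> 'm) set"
  where "cohomology_class M q c = cohomologous M q `` {c}"

text \<open>
  The connecting homomorphism \<open>H\<^sup>q(W\<^sub>1, N) \<rightarrow> H\<^sup>q\<^sup>+\<^sup>1(W\<^sub>1, L)\<close> of a short exact sequence
  \<open>0 \<rightarrow> L \<rightarrow> M \<rightarrow> N \<rightarrow> 0\<close> with maps \<open>i\<close> and \<open>p\<close>. The image of a class \<open>A\<close> is the set of all cocycles
  obtained from some representative \<open>a \<in> A\<close> and some lift \<open>b\<close> of \<open>a\<close> to a cochain with values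
  in \<open>M\<close>; changing \<open>b\<close> by a cochain with values in \<open>L\<close> shows that it is a full cohomology class.
\<close>

definition connecting_hom ::
    "'l::real_vector W1_module \<Rightarrow> ('l \<Rightarrow> 'm) \<Rightarrow> 'm::real_vector W1_module \<Rightarrow> ('m \<Rightarrow> 'n) \<Rightarrow>
     nat \<Rightarrow> (real fps list \<Rightarrow> 'n) set \<Rightarrow> (real fps list \<Rightarrow> 'l) set"
  where "connecting_hom L i M p q A =
    {z \<in> cocycles L (q + 1). \<exists>a\<in>A. \<exists>b\<in>cochains M q.
      (\<forall>xs. p (b xs) = a xs) \<and> (\<forall>xs. i (z xs) = coboundary M b xs)}"

definition alpha :: "real fps list \<Rightarrow> real fps"
  where "alpha xs = (case xs of
     [f, g] \<Rightarrow> det (vector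
       [vector [fps_deriv f, fps_deriv g],
        vector [fps_deriv (fps_deriv f), fps_deriv (fps_deriv g)]] :: real fps ^ 2 ^ 2)
   | _ \<Rightarrow> 0)"

definition godbillon_vey :: "real fps list \<Rightarrow> real"
  where "godbillon_vey xs = (case xs of
     [f, g, h] \<Rightarrow> det (vector
       [vector [f, g, h],
        vector [fps_deriv f, fps_deriv g, fps_deriv h],
        vector [fps_deriv (fps_deriv f), fps_deriv (fps_deriv g), fps_deriv (fps_deriv h)]]
       :: real fps ^ 3 ^ 3) $ 0
   | _ \<Rightarrow> 0)"

lemma W1_bracket_self: "W1_bracket f f = 0"
  by (simp add: W1_bracket_def mult.commute)

lemma W1_bracket_jacobi:
  "W1_bracket f (W1_bracket g h) + W1_bracket g (W1_bracket h f)
     + W1_bracket h (W1_bracket f g) = 0"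
  by (simp add: W1_bracket_def algebra_simps)

lemma densities_act_bracket:
  "act (densities l) (W1_bracket f g) a =
     act (densities l) f (act (densities l) g a) - act (densities l) g (act (densities l) f a)"
  by (simp add: densities_def W1_bracket_def fps_scaleR_conv algebra_simps)

lemma fps_const_equivariant:
  "fps_const (act trivial_module f r) = act (densities 0) f (fps_const r)"
  by (simp add: densities_def trivial_module_def)

lemma d_DR_equivariant: "d_DR (act (densities 0) f a) = act (densities 1) f (d_DR a)"
  by (simp add: densities_def d_DR_def algebra_simps)

lemma d_DR_kernel: "d_DR a = 0 \<longleftrightarrow> a \<in> range fps_const"
  by (auto simp: d_DR_def fps_deriv_eq_0_iff)

lemma d_DR_surj: "surj d_DR"
  unfolding d_DR_def surj_def by (metis fps_deriv_fps_integral)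

lemma cochain_2_swap:
  assumes c: "c \<in> cochains M 2"
  shows "c [g, f] = - c [f, g]"
proof -
  have lin: "linear (\<lambda>v. c (xs[i := v]))" if "length xs = 2" "i < 2" for xs i
    using c that by (simp add: cochains_def)
  have add1: "c [a + b, d] = c [a, d] + c [b, d]" for a b d
    using linear_add[OF lin[of "[0, d]" 0], of a b] by simp
  have add2: "c [d, a + b] = c [d, a] + c [d, b]" for a b d
    using linear_add[OF lin[of "[d, 0]" 1], of a b] by simp
  have alt: "c [a, a] = 0" for a
    using c by (simp add: cochains_def)
  have "0 = c [f + g, f + g]"
    by (simp add: alt)
  also have "\<dots> = c [f, g] + c [g, f]"
    by (simp only: add1 add2) (simp add: alt)
  finally show ?thesis
    by (simp add: eq_neg_iff_add_eq_0 add.commute)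
qed

lemma coboundary_2:
  assumes c: "c \<in> cochains M 2" and lin: "\<And>f. linear (act M f)"
  shows "coboundary M c [f, g, h] =
    act M f (c [g, h]) + act M g (c [h, f]) + act M h (c [f, g])
    - (c [W1_bracket f g, h] + c [W1_bracket g h, f] + c [W1_bracket h f, g])"
proof -
  have "c [W1_bracket f h, g] = - c [W1_bracket h f, g]"
  proof -
    have "linear (\<lambda>v. c (xs[i := v]))" if "length xs = 2" "i < 2" for xs i
      using c that by (simp add: cochains_def)
    from this[of "[0, g]" 0] have "linear (\<lambda>v. c [v, g])"
      by simp
    moreover have "W1_bracket f h = - W1_bracket h f"
      by (simp add: W1_bracket_def algebra_simps)
    ultimately show ?thesis
      using linear_neg[of "\<lambda>v. c [v, g]" "W1_bracket h f"] by simp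
  qed
  moreover have "act M g (c [f, h]) = - act M g (c [h, f])"
    using linear_neg[OF lin, of g "c [h, f]"] by (simp add: cochain_2_swap[OF c, of f h])
  moreover have "nths [f, g, h] (- {0}) = [g, h]" "nths [f, g, h] (- {Suc 0}) = [f, h]"
    "nths [f, g, h] (- {Suc (Suc 0)}) = [f, g]" "nths [f, g, h] (- {0, Suc 0}) = [h]"
    "nths [f, g, h] (- {0, Suc (Suc 0)}) = [g]" "nths [f, g, h] (- {Suc 0, Suc (Suc 0)}) = [f]"
    by (simp_all add: nths_Cons)
  ultimately show ?thesis
    by (simp add: coboundary_def lessThan_Suc)
qed

lemma godbillon_vey_eq:
  "godbillon_vey [f, g, h] =
     f $ 0 * (fps_deriv g * fps_deriv (fps_deriv h) - fps_deriv h * fps_deriv (fps_deriv g)) $ 0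
   - g $ 0 * (fps_deriv f * fps_deriv (fps_deriv h) - fps_deriv h * fps_deriv (fps_deriv f)) $ 0
   + h $ 0 * (fps_deriv f * fps_deriv (fps_deriv g) - fps_deriv g * fps_deriv (fps_deriv f)) $ 0"
  by (simp add: godbillon_vey_def det_3 algebra_simps)

lemma alpha_eq:
  "alpha [f, g] = fps_deriv f * fps_deriv (fps_deriv g) - fps_deriv g * fps_deriv (fps_deriv f)"
  by (simp add: alpha_def det_2)

end

theory Submission
  imports Defs
begin

text \<open>
  Lift \<open>\<alpha>\<close> to \<open>F\<^sub>0\<close> by taking the primitive \<open>b\<close> that vanishes at \<open>0\<close>. Since \<open>d_DR\<close> commutes with the
  coboundary and \<open>\<alpha>\<close> is closed, \<open>db\<close> is a constant, so it may be evaluated at \<open>x = 0\<close>. There the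
  terms \<open>b([X,Y],Z)\<close> vanish, and \<open>X \<cdot> b(Y,Z)\<close> becomes \<open>f(0) \<alpha>(Y,Z)(0)\<close>; the cyclic sum is
  the expansion of the Godbillon--Vey determinant along its first row. Any other representative
  \<open>\<alpha> + de\<close> has lifts \<open>b + d(\<integral>e) + k\<close> with \<open>k\<close> a real-valued cochain, which changes the
  result by \<open>dk\<close> only.
\<close>

section \<open>Continuity of the operations on power series\<close>

text \<open>\<open>fps_coeff_topology\<close> is the pullback of a product topology along
  \<open>fps_nth\<close>, so the universal property of products applies. The operations below are
  continuous because each coefficient of the result involves only finitely many input
  coefficients.\<close>

lemma continuous_map_fps_coeff_iff:
  "continuous_map X fps_coeff_topology h \<longleftrightarrow> (\<forall>n. continuous_map X euclideanreal (\<lambda>x. h x $ n))"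
proof -
  have top: "topspace fps_coeff_topology = UNIV"
    by (simp add: fps_coeff_topology_def topspace_pullback_topology)
  show ?thesis
  proof
    assume h: "continuous_map X fps_coeff_topology h"
    have "continuous_map fps_coeff_topology (product_topology (\<lambda>_::nat. euclideanreal) UNIV) (fps_nth \<circ> id)"
      unfolding fps_coeff_topology_def
      by (metis comp_id continuous_map_id continuous_map_pullback id_comp)
    from continuous_map_compose[OF h this]
    show "\<forall>n. continuous_map X euclideanreal (\<lambda>x. h x $ n)"
      by (simp add: continuous_map_componentwise_UNIV o_def)
  next
    assume "\<forall>n. continuous_map X euclideanreal (\<lambda>x. h x $ n)"
    then have "continuous_map X (product_topology (\<lambda>_::nat. euclideanreal) UNIV) (fps_nth \<circ> h)"
      by (simp add: continuous_map_componentwise_UNIV o_def)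
    then show "continuous_map X fps_coeff_topology h"
      unfolding fps_coeff_topology_def by (rule continuous_map_pullback') simp
  qed
qed

lemma continuous_map_fps_nth:
  "continuous_map X fps_coeff_topology h \<Longrightarrow> continuous_map X euclideanreal (\<lambda>x. h x $ n)"
  by (simp add: continuous_map_fps_coeff_iff)

lemma continuous_map_fps_add:
  assumes "continuous_map X fps_coeff_topology h" "continuous_map X fps_coeff_topology k"
  shows "continuous_map X fps_coeff_topology (\<lambda>x. h x + k x)"
  using assms by (simp add: continuous_map_fps_coeff_iff continuous_map_add)

lemma continuous_map_fps_diff:
  assumes "continuous_map X fps_coeff_topology h" "continuous_map X fps_coeff_topology k"
  shows "continuous_map X fps_coeff_topology (\<lambda>x. h x - k x)"
  using assms by (simp add: continuous_map_fps_coeff_iff continuous_map_diff)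

lemma continuous_map_fps_mult:
  assumes "continuous_map X fps_coeff_topology h" "continuous_map X fps_coeff_topology k"
  shows "continuous_map X fps_coeff_topology (\<lambda>x. h x * k x)"
  using assms unfolding continuous_map_fps_coeff_iff fps_mult_nth
  by (intro allI continuous_map_sum continuous_map_real_mult) auto

lemma continuous_map_fps_scaleR:
  assumes "continuous_map X fps_coeff_topology h"
  shows "continuous_map X fps_coeff_topology (\<lambda>x. r *\<^sub>R h x)"
  using assms by (simp add: continuous_map_fps_coeff_iff continuous_map_real_mult_left)

lemma continuous_map_fps_deriv:
  assumes "continuous_map X fps_coeff_topology h"
  shows "continuous_map X fps_coeff_topology (\<lambda>x. fps_deriv (h x))"
  using assms by (simp add: continuous_map_fps_coeff_iff continuous_map_real_mult_left)

lemma continuous_map_fps_integral0: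
  assumes "continuous_map X fps_coeff_topology h"
  shows "continuous_map X fps_coeff_topology (\<lambda>x. fps_integral0 (h x))"
  unfolding continuous_map_fps_coeff_iff
proof
  fix n
  show "continuous_map X euclideanreal (\<lambda>x. fps_integral0 (h x) $ n)"
    \<comment> \<open>The coefficient at \<open>0\<close> is the constant \<open>0\<close>; the one
      at \<open>Suc m\<close> is coefficient \<open>m\<close> of the integrand divided by
      \<open>Suc m\<close>.\<close>
    using assms unfolding continuous_map_fps_coeff_iff
    by (cases n) (simp_all add: fps_integral_def continuous_map_real_mult_left)
qed

lemma continuous_map_fps_const:
  assumes "continuous_map X euclideanreal h"
  shows "continuous_map X fps_coeff_topology (\<lambda>x. fps_const (h x))"
  unfolding continuous_map_fps_coeff_iff
proof
  fix n
  show "continuous_map X euclideanreal (\<lambda>x. fps_const (h x) $ n)"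
    using assms by (cases n) simp_all
qed

lemma continuous_map_W1_bracket:
  assumes "continuous_map X fps_coeff_topology h" "continuous_map X fps_coeff_topology k"
  shows "continuous_map X fps_coeff_topology (\<lambda>x. W1_bracket (h x) (k x))"
  unfolding W1_bracket_def
  by (intro continuous_map_fps_diff continuous_map_fps_mult continuous_map_fps_deriv assms)

lemma continuous_map_act_densities:
  assumes "continuous_map X fps_coeff_topology h" "continuous_map X fps_coeff_topology k"
  shows "continuous_map X fps_coeff_topology (\<lambda>x. act (densities l) (h x) (k x))"
  unfolding densities_def W1_module.simps
  by (intro continuous_map_fps_add continuous_map_fps_scaleR continuous_map_fps_mult
      continuous_map_fps_deriv assms)

section \<open>Linearity of the structure maps and actions\<close>

lemma linear_fps_deriv: "linear (fps_deriv :: real fps \<Rightarrow> real fps)"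
  by (rule linearI) (simp_all add: fps_eq_iff algebra_simps)

lemma linear_d_DR: "linear d_DR"
  unfolding d_DR_def by (rule linear_fps_deriv)

lemma linear_fps_const: "linear (fps_const :: real \<Rightarrow> real fps)"
  by (rule linearI) (simp_all add: fps_eq_iff)

lemma linear_fps_nth: "linear (\<lambda>f :: real fps. f $ n)"
  by (rule linearI) simp_all

lemma linear_fps_integral0: "linear (fps_integral0 :: real fps \<Rightarrow> real fps)"
  by (rule linearI) (simp_all add: fps_eq_iff fps_integral_def field_simps)

lemma linear_act_densities: "linear (act (densities l) f)"
  by (rule linearI) (simp_all add: densities_def fps_scaleR_conv algebra_simps)

lemma linear_act_densities_left: "linear (\<lambda>f. act (densities l) f a)"
  by (rule linearI) (simp_all add: densities_def fps_scaleR_conv algebra_simps)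

lemma linear_act_trivial: "linear (act trivial_module f)"
  by (simp add: trivial_module_def linear_zero)

lemma mtopology_densities [simp]: "mtopology (densities l) = fps_coeff_topology"
  by (simp add: densities_def)

lemma mtopology_trivial [simp]: "mtopology trivial_module = euclideanreal"
  by (simp add: trivial_module_def)

lemma linear_W1_bracket_left: "linear (\<lambda>f. W1_bracket f g)"
  by (rule linearI) (simp_all add: W1_bracket_def fps_scaleR_conv algebra_simps)

lemma linear_W1_bracket_right: "linear (W1_bracket f)"
  by (rule linearI) (simp_all add: W1_bracket_def fps_scaleR_conv algebra_simps)

section \<open>Criteria for being a cochain\<close>

lemma cochains_0: "c \<in> cochains M q \<Longrightarrow> length xs \<noteq> q \<Longrightarrow> c xs = 0"
  by (simp add: cochains_def)

lemma cochains_linear: "c \<in> cochains M q \<Longrightarrow> length xs = q \<Longrightarrow> i < q \<Longrightarrow> linear (\<lambda>v. c (xs[i := v]))"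
  by (simp add: cochains_def)

lemma cochains_continuous:
  "c \<in> cochains M q \<Longrightarrow> continuous_map (product_topology (\<lambda>_. fps_coeff_topology) {..<q}) (mtopology M)
      (\<lambda>v. c (map v [0..<q]))"
  by (simp add: cochains_def)

text \<open>Case analysis on a list of length 2 turns the conditions on list updates and repeated
  entries into conditions on explicit arguments, which formulas such as \<open>alpha_eq\<close> can
  verify.\<close>

lemma cochains_2I:
  assumes "\<And>xs. length xs \<noteq> 2 \<Longrightarrow> c xs = 0"
    and "\<And>g. linear (\<lambda>f. c [f, g])" and "\<And>f. linear (\<lambda>g. c [f, g])"
    and "\<And>f. c [f, f] = 0"
    and "continuous_map (product_topology (\<lambda>_. fps_coeff_topology) {..<2::nat}) (mtopology M)
      (\<lambda>v. c [v 0, v 1])"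
  shows "c \<in> cochains M 2"
proof -
  have "linear (\<lambda>v. c (xs[i := v]))" if len: "length xs = 2" and i: "i < 2" for xs i
  proof -
    obtain f g where "xs = [f, g]"
      using len by (auto simp: length_Suc_conv eval_nat_numeral)
    then show ?thesis
      using i assms(2,3) by (auto simp: less_2_cases_iff)
  qed
  moreover have "c xs = 0" if "length xs = 2" "\<not> distinct xs" for xs
    using that assms(4) by (auto simp: length_Suc_conv numeral_2_eq_2)
  moreover have "[0..<2] = [0, 1]"
    by (simp add: upt_rec)
  ultimately show ?thesis
    using assms(1,5) by (simp add: cochains_def)
qed

lemma cochains_3I:
  assumes "\<And>xs. length xs \<noteq> 3 \<Longrightarrow> c xs = 0"
    and "\<And>g h. linear (\<lambda>f. c [f, g, h])" and "\<And>f h. linear (\<lambda>g. c [f, g, h])"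
    and "\<And>f g. linear (\<lambda>h. c [f, g, h])"
    and "\<And>f g. c [f, f, g] = 0" and "\<And>f g. c [f, g, f] = 0" and "\<And>f g. c [g, f, f] = 0"
    and "continuous_map (product_topology (\<lambda>_. fps_coeff_topology) {..<3::nat}) (mtopology M)
      (\<lambda>v. c [v 0, v 1, v 2])"
  shows "c \<in> cochains M 3"
proof -
  have "linear (\<lambda>v. c (xs[i := v]))" if len: "length xs = 3" and i: "i < 3" for xs i
  proof -
    obtain f g h where "xs = [f, g, h]"
      using len by (auto simp: length_Suc_conv eval_nat_numeral)
    moreover have "i = 0 \<or> i = 1 \<or> i = 2"
      using i by auto
    ultimately show ?thesis
      using assms(2,3,4) by auto
  qed
  moreover have "c xs = 0" if "length xs = 3" "\<not> distinct xs" for xs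
    using that assms(5,6,7) by (auto simp: length_Suc_conv numeral_3_eq_3)
  moreover have "[0..<3] = [0, 1, 2]"
    by (simp add: upt_rec)
  ultimately show ?thesis
    using assms(1,8) by (simp add: cochains_def)
qed

lemma cochains_densities_add:
  assumes "c \<in> cochains (densities l) q" "c' \<in> cochains (densities l) q"
  shows "(\<lambda>xs. c xs + c' xs) \<in> cochains (densities l) q"
  using assms by (auto simp: cochains_def intro: linear_compose_add continuous_map_fps_add)

lemma cochains_densities_diff:
  assumes "c \<in> cochains (densities l) q" "c' \<in> cochains (densities l) q"
  shows "(\<lambda>xs. c xs - c' xs) \<in> cochains (densities l) q"
  using assms by (auto simp: cochains_def intro: linear_compose_sub continuous_map_fps_diff)

text \<open>Linearity of \<open>p\<close> preserves multilinearity and, through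
  \<open>p 0 = 0\<close>, both vanishing conditions. Later \<open>p\<close> is the primitive, the
  inclusion of constants or evaluation at \<open>0\<close>.\<close>

lemma cochains_linear_image:
  assumes c: "c \<in> cochains M q" and p: "linear p"
    and cont: "\<And>X :: (nat \<Rightarrow> real fps) topology. \<And>h. continuous_map X (mtopology M) h \<Longrightarrow>
      continuous_map X (mtopology N) (\<lambda>x. p (h x))"
  shows "(\<lambda>xs. p (c xs)) \<in> cochains N q"
proof -
  have "linear (\<lambda>v. p (c (xs[i := v])))" if "length xs = q" "i < q" for xs i
    using linear_compose[OF cochains_linear[OF c that] p] by (simp add: o_def)
  then show ?thesis
    using c cont[OF cochains_continuous[OF c]] linear_0[OF p] by (auto simp: cochains_def)
qed

section \<open>Degree and naturality of the coboundary\<close>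

lemma length_nths_remove:
  assumes "i < length xs"
  shows "length (nths xs (- {i})) = length xs - 1"
proof -
  have "{k. k < length xs \<and> k \<in> - {i}} = {..<length xs} - {i}"
    by auto
  then show ?thesis
    using assms by (simp add: length_nths)
qed

lemma length_nths_remove2:
  assumes "i < j" "j < length xs"
  shows "length (nths xs (- {i, j})) = length xs - 2"
proof -
  have "{k. k < length xs \<and> k \<in> - {i, j}} = {..<length xs} - {i, j}"
    by auto
  moreover have "card ({..<length xs} - {i, j}) = length xs - 2"
    using assms by (subst card_Diff_subset) auto
  ultimately show ?thesis
    by (simp add: length_nths)
qed

text \<open>Each term evaluates \<open>c\<close> on a list one entry shorter than \<open>xs\<close>:
  one entry is removed, or two are replaced by their bracket. Closedness proofs therefore only treat
  lists of the one relevant length.\<close>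

lemma coboundary_0:
  assumes c: "\<And>xs. length xs \<noteq> q \<Longrightarrow> c xs = 0" and act: "\<And>f. linear (act M f)"
    and len: "length xs \<noteq> q + 1"
  shows "coboundary M c xs = 0"
proof -
  have "c (nths xs (- {i})) = 0" if "i < length xs" for i
    using that len by (intro c) (simp add: length_nths_remove)
  moreover have "c (W1_bracket (xs ! i) (xs ! j) # nths xs (- {i, j})) = 0"
    if "i < j" "j < length xs" for i j
    using that len by (intro c) (simp add: length_nths_remove2)
  ultimately show ?thesis
    by (simp add: coboundary_def linear_0[OF act])
qed

lemma coboundary_add:
  assumes "\<And>f. linear (act M f)"
  shows "coboundary M (\<lambda>xs. c xs + c' xs) xs = coboundary M c xs + coboundary M c' xs"
  by (simp add: coboundary_def linear_add[OF assms] scaleR_add_right sum.distrib)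

text \<open>A linear equivariant map passes through the signs, sums and actions in the formula.
  Applied to \<open>d_DR\<close> and \<open>fps_const\<close>, this makes both maps of the exact
  sequence commute with the differential.\<close>

lemma coboundary_natural:
  assumes p: "linear p" and equiv: "\<And>f a. p (act M f a) = act N f (p a)"
  shows "coboundary N (\<lambda>xs. p (c xs)) xs = p (coboundary M c xs)"
  by (simp add: coboundary_def linear_add[OF p] linear_sum[OF p] linear_cmul[OF p] equiv)

section \<open>One-cochains and the square of the differential\<close>

lemma coboundary_1:
  "coboundary M c [f, g] = act M f (c [g]) - act M g (c [f]) - c [W1_bracket f g]"
proof -
  have "nths [f, g] (- {0}) = [g]" "nths [f, g] (- {Suc 0}) = [f]" "nths [f, g] (- {0, Suc 0}) = []"
    by (simp_all add: nths_Cons)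
  then show ?thesis
    by (simp add: coboundary_def lessThan_Suc)
qed

lemma cochain_1_linear:
  assumes "c \<in> cochains M 1"
  shows "linear (\<lambda>f. c [f])"
  using cochains_linear[OF assms, of "[0]" 0] by simp

lemma cochain_1_continuous:
  assumes c: "c \<in> cochains M 1" and h: "continuous_map X fps_coeff_topology h"
  shows "continuous_map X (mtopology M) (\<lambda>x. c [h x])"
proof -
  \<comment> \<open>Points of a product over \<open>{..<1}\<close> are extensional functions, so the
    argument is restricted to that index set.\<close>
  have "continuous_map X (product_topology (\<lambda>_. fps_coeff_topology) {..<1::nat})
      (\<lambda>x. \<lambda>i\<in>{..<1}. h x)"
    using h by (auto simp: continuous_map_componentwise)
  from continuous_map_compose[OF this cochains_continuous[OF c]]
  show ?thesis
    by (simp add: o_def)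
qed

text \<open>Makes the correction term of a lift a genuine cochain, and allows
  \<open>coboundary_2\<close> to be applied to it in the next lemma.\<close>

lemma coboundary_1_cochain:
  assumes c: "c \<in> cochains (densities l) 1"
  shows "coboundary (densities l) c \<in> cochains (densities l) 2"
proof (rule cochains_2I)
  note lin = cochain_1_linear[OF c]
  show "coboundary (densities l) c xs = 0" if "length xs \<noteq> 2" for xs
    using that by (intro coboundary_0[of 1] cochains_0[OF c] linear_act_densities) simp_all
  show "linear (\<lambda>f. coboundary (densities l) c [f, g])" for g
    unfolding coboundary_1
    using linear_compose[OF linear_W1_bracket_left lin] linear_compose[OF lin linear_act_densities]
    by (intro linear_compose_sub linear_act_densities_left) (simp_all add: o_def)
  show "linear (\<lambda>g. coboundary (densities l) c [f, g])" for f
    unfolding coboundary_1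
    using linear_compose[OF linear_W1_bracket_right lin] linear_compose[OF lin linear_act_densities]
    by (intro linear_compose_sub linear_act_densities_left) (simp_all add: o_def)
  show "coboundary (densities l) c [f, f] = 0" for f
    using linear_0[OF lin] by (simp add: coboundary_1 W1_bracket_self)
  have *: "continuous_map X fps_coeff_topology (\<lambda>x. c [h x])"
    if "continuous_map X fps_coeff_topology h" for X :: "(nat \<Rightarrow> real fps) topology" and h
    using cochain_1_continuous[OF c that] by simp
  show "continuous_map (product_topology (\<lambda>_. fps_coeff_topology) {..<2::nat}) (mtopology (densities l))
      (\<lambda>v. coboundary (densities l) c [v 0, v 1])"
    unfolding coboundary_1 mtopology_densities
    by (intro continuous_map_fps_diff continuous_map_act_densities * continuous_map_W1_bracket
        continuous_map_product_projection) auto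
qed

text \<open>Iterated actions cancel against actions of brackets by
  \<open>densities_act_bracket\<close>, mixed terms cancel in pairs, and the nested brackets vanish
  by the Jacobi identity.\<close>

lemma coboundary_coboundary_1:
  assumes c: "c \<in> cochains (densities l) 1"
  shows "coboundary (densities l) (coboundary (densities l) c) xs = 0"
proof (cases "length xs = 3")
  case True
  then obtain f g h where xs: "xs = [f, g, h]"
    by (auto simp: length_Suc_conv numeral_3_eq_3)
  note lin = cochain_1_linear[OF c]
  \<comment> \<open>Antisymmetry moves a nested bracket to the second slot, the form in which the
    Jacobi identity is stated.\<close>
  have swap: "c [W1_bracket u v] = - c [W1_bracket v u]" for u v
    using linear_neg[OF lin, of "W1_bracket v u"] by (simp add: W1_bracket_def algebra_simps)
  have "c [W1_bracket f (W1_bracket g h)] + c [W1_bracket g (W1_bracket h f)]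
      + c [W1_bracket h (W1_bracket f g)] = 0"
    using linear_0[OF lin] by (simp flip: linear_add[OF lin] add: W1_bracket_jacobi)
  \<comment> \<open>Simplification leaves the Jacobi sum with one term moved across the equation,
    which \<open>minus_unique\<close> settles.\<close>
  then show ?thesis
    unfolding xs coboundary_2[OF coboundary_1_cochain[OF c] linear_act_densities] coboundary_1
    by (simp add: densities_act_bracket linear_diff[OF linear_act_densities]
        swap[of "W1_bracket _ _"] swap[of h f] linear_neg[OF linear_act_densities]
        linear_add[OF linear_act_densities] algebra_simps)
      (erule minus_unique)
next
  case False
  then show ?thesis
    by (intro coboundary_0[of 2] cochains_0[OF coboundary_1_cochain[OF c]] linear_act_densities) simp_all
qed

section \<open>The two cocycles\<close>

lemma alpha_cochain: "alpha \<in> cochains (densities 1) 2"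
proof (rule cochains_2I)
  show "alpha xs = 0" if "length xs \<noteq> 2" for xs
    using that by (auto simp: alpha_def split: list.splits)
  show "linear (\<lambda>f. alpha [f, g])" for g
    by (rule linearI) (simp_all add: alpha_eq fps_scaleR_conv algebra_simps)
  show "linear (\<lambda>g. alpha [f, g])" for f
    by (rule linearI) (simp_all add: alpha_eq fps_scaleR_conv algebra_simps)
  show "alpha [f, f] = 0" for f
    by (simp add: alpha_eq)
  show "continuous_map (product_topology (\<lambda>_. fps_coeff_topology) {..<2::nat}) (mtopology (densities 1))
      (\<lambda>v. alpha [v 0, v 1])"
    unfolding alpha_eq mtopology_densities
    by (intro continuous_map_fps_diff continuous_map_fps_mult continuous_map_fps_deriv
        continuous_map_product_projection) auto
qed

text \<open>On triples, closedness is a polynomial identity in the series and their derivatives,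
  verified by ring normalisation.\<close>

lemma alpha_cocycle: "alpha \<in> cocycles (densities 1) 2"
proof -
  have "coboundary (densities 1) alpha xs = 0" for xs
  proof (cases "length xs = 3")
    case True
    then obtain f g h where xs: "xs = [f, g, h]"
      by (auto simp: length_Suc_conv numeral_3_eq_3)
    show ?thesis
      unfolding xs coboundary_2[OF alpha_cochain linear_act_densities]
      by (simp add: alpha_eq densities_def W1_bracket_def algebra_simps)
  next
    case False
    then show ?thesis
      by (intro coboundary_0[of 2] cochains_0[OF alpha_cochain] linear_act_densities) simp_all
  qed
  then show ?thesis
    by (simp add: cocycles_def alpha_cochain)
qed

lemma godbillon_vey_cochain: "godbillon_vey \<in> cochains trivial_module 3"
proof (rule cochains_3I)
  show "godbillon_vey xs = 0" if "length xs \<noteq> 3" for xs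
    using that by (auto simp: godbillon_vey_def split: list.splits)
  show "linear (\<lambda>f. godbillon_vey [f, g, h])" for g h
    by (rule linearI) (simp_all add: godbillon_vey_eq algebra_simps)
  show "linear (\<lambda>g. godbillon_vey [f, g, h])" for f h
    by (rule linearI) (simp_all add: godbillon_vey_eq algebra_simps)
  show "linear (\<lambda>h. godbillon_vey [f, g, h])" for f g
    by (rule linearI) (simp_all add: godbillon_vey_eq algebra_simps)
  show "godbillon_vey [f, f, g] = 0" "godbillon_vey [f, g, f] = 0" "godbillon_vey [g, f, f] = 0" for f g
    by (simp_all add: godbillon_vey_eq algebra_simps)
  show "continuous_map (product_topology (\<lambda>_. fps_coeff_topology) {..<3::nat}) (mtopology trivial_module)
      (\<lambda>v. godbillon_vey [v 0, v 1, v 2])"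
    unfolding godbillon_vey_eq mtopology_trivial
    by (intro continuous_map_add continuous_map_diff continuous_map_real_mult continuous_map_fps_nth
        continuous_map_fps_diff continuous_map_fps_mult continuous_map_fps_deriv
        continuous_map_product_projection) auto
qed

text \<open>The action is trivial, so only the bracket terms remain, one for each of six pairs.
  Evaluated at \<open>0\<close>, they cancel as polynomials in the Taylor coefficients.\<close>

lemma godbillon_vey_cocycle: "godbillon_vey \<in> cocycles trivial_module 3"
proof -
  have "coboundary trivial_module godbillon_vey xs = 0" for xs
  proof (cases "length xs = 4")
    case True
    then obtain f g h k where xs: "xs = [f, g, h, k]"
      by (auto simp: length_Suc_conv eval_nat_numeral)
    have "nths [f, g, h, k] (- {0, Suc 0}) = [h, k]"
      "nths [f, g, h, k] (- {0, Suc (Suc 0)}) = [g, k]"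
      "nths [f, g, h, k] (- {0, Suc (Suc (Suc 0))}) = [g, h]"
      "nths [f, g, h, k] (- {Suc 0, Suc (Suc 0)}) = [f, k]"
      "nths [f, g, h, k] (- {Suc 0, Suc (Suc (Suc 0))}) = [f, h]"
      "nths [f, g, h, k] (- {Suc (Suc 0), Suc (Suc (Suc 0))}) = [f, g]"
      by (simp_all add: nths_Cons)
    then show ?thesis
      unfolding xs
      by (simp add: coboundary_def lessThan_Suc trivial_module_def godbillon_vey_eq W1_bracket_def
          algebra_simps)
  next
    case False
    then show ?thesis
      by (intro coboundary_0[of 3] cochains_0[OF godbillon_vey_cochain] linear_act_trivial) simp_all
  qed
  then show ?thesis
    by (simp add: cocycles_def godbillon_vey_cochain)
qed

section \<open>The normalised lift of \<open>alpha\<close>\<close>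

text \<open>Splits the identification of the lift's coboundary into a check of derivatives, supplied
  by naturality, and a check at \<open>0\<close>.\<close>

lemma fps_eqI_deriv:
  fixes a b :: "real fps"
  assumes "fps_deriv a = fps_deriv b" "a $ 0 = b $ 0"
  shows "a = b"
  using assms by (simp add: fps_deriv_eq_iff)

lemma alpha_lift_cochain: "(\<lambda>xs. fps_integral0 (alpha xs)) \<in> cochains (densities 0) 2"
  by (rule cochains_linear_image[OF alpha_cochain linear_fps_integral0])
    (simp add: continuous_map_fps_integral0)

lemma d_DR_integral0: "d_DR (fps_integral0 a) = a"
  by (simp add: d_DR_def fps_deriv_fps_integral)

text \<open>For the primitive normalised at \<open>0\<close>, the identity holds between cochains,
  with no coboundary correction.\<close>

lemma coboundary_alpha_lift:
  "coboundary (densities 0) (\<lambda>xs. fps_integral0 (alpha xs)) xs = fps_const (godbillon_vey xs)"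
proof (rule fps_eqI_deriv)
  let ?b = "\<lambda>xs. fps_integral0 (alpha xs)"
  have "d_DR (coboundary (densities 0) ?b xs) = coboundary (densities 1) (\<lambda>xs. d_DR (?b xs)) xs"
    by (rule coboundary_natural[OF linear_d_DR d_DR_equivariant, symmetric])
  also have "\<dots> = 0"
    using alpha_cocycle by (simp add: d_DR_integral0 cocycles_def)
  finally show "fps_deriv (coboundary (densities 0) ?b xs) = fps_deriv (fps_const (godbillon_vey xs))"
    by (simp add: d_DR_def)
  show "coboundary (densities 0) ?b xs $ 0 = fps_const (godbillon_vey xs) $ 0"
  proof (cases "length xs = 3")
    case True
    then obtain f g h where xs: "xs = [f, g, h]"
      by (auto simp: length_Suc_conv numeral_3_eq_3)
    \<comment> \<open>Weight \<open>0\<close> leaves only \<open>f * fps_deriv a\<close> in the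
      action, and differentiating the lift returns \<open>alpha\<close>; the bracket terms have
      constant coefficient \<open>0\<close>.\<close>
    show ?thesis
      unfolding xs coboundary_2[OF alpha_lift_cochain linear_act_densities]
      by (simp add: densities_def fps_deriv_fps_integral alpha_eq godbillon_vey_eq algebra_simps)
  next
    case False
    then have "coboundary (densities 0) ?b xs = 0"
      by (intro coboundary_0[of 2] cochains_0[OF alpha_lift_cochain] linear_act_densities) simp_all
    with False show ?thesis
      by (simp add: cochains_0[OF godbillon_vey_cochain])
  qed
qed

lemma coboundary_const:
  "coboundary (densities 0) (\<lambda>xs. fps_const (k xs)) xs = fps_const (coboundary trivial_module k xs)"
  by (rule coboundary_natural[OF linear_fps_const fps_const_equivariant])

section \<open>Comparison of the cohomology classes\<close>

text \<open>Degree \<open>Suc q\<close> avoids the separate clause of \<open>coboundaries\<close> in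
  degree \<open>0\<close>, so every coboundary comes from a cochain of degree
  \<open>q\<close>.\<close>

lemma cohomology_class_iff:
  assumes "c \<in> cocycles M (Suc q)"
  shows "z \<in> cohomology_class M (Suc q) c \<longleftrightarrow>
    z \<in> cocycles M (Suc q) \<and> (\<exists>k\<in>cochains M q. \<forall>xs. z xs = c xs + coboundary M k xs)"
  using assms by (auto simp: cohomology_class_def cohomologous_def coboundaries_def fun_eq_iff
      image_iff algebra_simps)

theorem lemma1:
  shows "alpha \<in> cocycles (densities 1) 2 \<and>
    godbillon_vey \<in> cocycles trivial_module 3 \<and>
    connecting_hom trivial_module fps_const (densities 0) d_DR 2
      (cohomology_class (densities 1) 2 alpha)
    = cohomology_class trivial_module 3 godbillon_vey"
proof (intro conjI set_eqI iffI)
  show "alpha \<in> cocycles (densities 1) 2" "godbillon_vey \<in> cocycles trivial_module 3"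
    by (fact alpha_cocycle godbillon_vey_cocycle)+
  let ?b = "\<lambda>xs. fps_integral0 (alpha xs)"
  have class_alpha: "a \<in> cohomology_class (densities 1) 2 alpha \<longleftrightarrow> a \<in> cocycles (densities 1) 2 \<and>
      (\<exists>e\<in>cochains (densities 1) 1. \<forall>xs. a xs = alpha xs + coboundary (densities 1) e xs)" for a
    using cohomology_class_iff[of alpha "densities 1" 1 a] alpha_cocycle by (simp add: numeral_2_eq_2)
  have class_gv: "z \<in> cohomology_class trivial_module 3 godbillon_vey \<longleftrightarrow>
      z \<in> cocycles trivial_module 3 \<and>
      (\<exists>k\<in>cochains trivial_module 2. \<forall>xs. z xs = godbillon_vey xs + coboundary trivial_module k xs)" for z
    using cohomology_class_iff[of godbillon_vey trivial_module 2 z] godbillon_vey_cocycle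
    by (simp add: numeral_3_eq_3 numeral_2_eq_2)
  fix z
  {
    assume "z \<in> connecting_hom trivial_module fps_const (densities 0) d_DR 2
      (cohomology_class (densities 1) 2 alpha)"
    then obtain a b where z: "z \<in> cocycles trivial_module 3"
      and a: "a \<in> cohomology_class (densities 1) 2 alpha" and b: "b \<in> cochains (densities 0) 2"
      and pb: "\<And>xs. d_DR (b xs) = a xs" and zb: "\<And>xs. fps_const (z xs) = coboundary (densities 0) b xs"
      by (auto simp: connecting_hom_def)
    from a obtain e where e: "e \<in> cochains (densities 1) 1"
      and ae: "\<And>xs. a xs = alpha xs + coboundary (densities 1) e xs"
      by (auto simp: class_alpha)
    \<comment> \<open>A primitive of \<open>e\<close>; its coboundary \<open>D\<close> lifts the
      exact part of \<open>a\<close>.\<close>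
    define E where "E = (\<lambda>xs. fps_integral0 (e xs))"
    have E: "E \<in> cochains (densities 0) 1"
      unfolding E_def by (rule cochains_linear_image[OF e linear_fps_integral0])
        (simp add: continuous_map_fps_integral0)
    define D where "D = coboundary (densities 0) E"
    have D: "D \<in> cochains (densities 0) 2"
      unfolding D_def by (rule coboundary_1_cochain[OF E])
    have dD: "d_DR (D xs) = coboundary (densities 1) e xs" for xs
      unfolding D_def coboundary_natural[where N = "densities 1", OF linear_d_DR d_DR_equivariant, symmetric]
      by (simp add: E_def d_DR_integral0)
    \<comment> \<open>Both \<open>b\<close> and the sum of \<open>?b\<close> and \<open>D\<close>
      lift \<open>a\<close>, so their difference is a constant series, recovered from its
      coefficient at \<open>0\<close>.\<close>
    define k where "k = (\<lambda>xs. (b xs - ?b xs - D xs) $ 0)"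
    have "(\<lambda>xs. b xs - ?b xs - D xs) \<in> cochains (densities 0) 2"
      by (intro cochains_densities_diff b D alpha_lift_cochain)
    then have k: "k \<in> cochains trivial_module 2"
      unfolding k_def by (rule cochains_linear_image[OF _ linear_fps_nth])
        (simp add: continuous_map_fps_nth)
    have "d_DR (b xs - ?b xs - D xs) = 0" for xs
      by (simp add: linear_diff[OF linear_d_DR] pb dD ae d_DR_integral0)
    then have "b xs - ?b xs - D xs \<in> range fps_const" for xs
      by (simp only: d_DR_kernel)
    then have "b xs - ?b xs - D xs = fps_const (k xs)" for xs
      unfolding k_def by (metis fps_nth_fps_const image_iff)
    then have "b = (\<lambda>xs. ?b xs + D xs + fps_const (k xs))"
      by (auto simp: algebra_simps fun_eq_iff)
    \<comment> \<open>The summand \<open>?b\<close> contributes \<open>godbillon_vey\<close>,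
      \<open>D\<close> contributes \<open>0\<close> as it is itself a coboundary, and the last
      summand contributes the coboundary of \<open>k\<close>.\<close>
    then have "fps_const (z xs) = fps_const (godbillon_vey xs + coboundary trivial_module k xs)" for xs
      unfolding zb
      by (simp add: coboundary_add linear_act_densities coboundary_alpha_lift coboundary_const
          D_def coboundary_coboundary_1[OF E])
    then have "z xs = godbillon_vey xs + coboundary trivial_module k xs" for xs
      by (metis fps_nth_fps_const)
    with z k show "z \<in> cohomology_class trivial_module 3 godbillon_vey"
      by (auto simp: class_gv)
  }
  {
    assume "z \<in> cohomology_class trivial_module 3 godbillon_vey"
    then obtain k where z: "z \<in> cocycles trivial_module 3" and k: "k \<in> cochains trivial_module 2"
      and zk: "\<And>xs. z xs = godbillon_vey xs + coboundary trivial_module k xs"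
      by (auto simp: class_gv)
    \<comment> \<open>Adding the constants \<open>k\<close> keeps a lift of \<open>alpha\<close> and
      changes its coboundary by that of \<open>k\<close>, so \<open>alpha\<close> itself serves as
      representative.\<close>
    let ?c = "\<lambda>xs. ?b xs + fps_const (k xs)"
    have "(\<lambda>xs. fps_const (k xs)) \<in> cochains (densities 0) 2"
      by (rule cochains_linear_image[OF k linear_fps_const]) (simp add: continuous_map_fps_const)
    then have "?c \<in> cochains (densities 0) 2"
      by (intro cochains_densities_add alpha_lift_cochain)
    moreover have "d_DR (?c xs) = alpha xs" for xs
      by (simp add: linear_add[OF linear_d_DR] d_DR_integral0) (simp add: d_DR_def)
    moreover have "fps_const (z xs) = coboundary (densities 0) ?c xs" for xs
      by (simp add: coboundary_add linear_act_densities coboundary_alpha_lift coboundary_const zk)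
    \<comment> \<open>The zero cochain is the witness that \<open>alpha\<close> lies in its own
      class.\<close>
    moreover have "(\<lambda>_. 0) \<in> cochains (densities 1) 1"
      by (simp add: cochains_def linear_zero continuous_map_fps_coeff_iff)
    then have "alpha \<in> cohomology_class (densities 1) 2 alpha"
      using alpha_cocycle
      by (auto simp: class_alpha coboundary_def linear_0[OF linear_act_densities] intro!: bexI[of _ "\<lambda>_. 0"])
    ultimately show "z \<in> connecting_hom trivial_module fps_const (densities 0) d_DR 2
      (cohomology_class (densities 1) 2 alpha)"
      using z unfolding connecting_hom_def by auto
  }
qed

end
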